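(* Let $X$ be a Banach space with $B_X=\mathrm{co}(\{x_1,\dots,x_n\})$ for some $x_1,\dots,x_n\in S_X$, and assume that $Y$ is a dual Banach space. Then every tensor in $X\widehat{\otimes}_\pi Y$ attains its projective tensor norm, that is, $\mathrm{NA}_\pi(X\widehat{\otimes}_\pi Y)=X\widehat{\otimes}_\pi Y$.
   Context: $B_X$ and $S_X$ are the closed unit ball and unit sphere of $X$, and $\mathrm{co}$ denotes the convex hull. "$Y$ is a dual space" means $Y=Z^*$ (isometrically) for some Banach space $Z$. $X\widehat{\otimes}_\pi Y$ is the projective tensor product, the completion of $X\otimes Y$ under $\|z\|_\pi=\inf\{\sum_{i=1}^n\|x_i\|\|y_i\|: z=\sum_{i=1}^n x_i\otimes y_i\}$. An element $z\in X\widehat{\otimes}_\pi Y$ attains its projective norm if there is a bounded sequence $(x_n,y_n)_{n=1}^\infty\subseteq X\times Y$ with $\sum_{n=1}^\infty\|x_n\|\|y_n\|<\infty$, $z=\sum_{n=1}^\infty x_n\otimes y_n$ and $\|z\|_\pi=\sum_{n=1}^\infty\|x_n\|\|y_n\|$; the set of all such $z$ is denoted $\mathrm{NA}_\pi(X\widehat{\otimes}_\pi Y)$. *)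

theory Defs
  imports "HOL-Analysis.Analysis"
begin

section \<open>Norming functionals (Hahn--Banach)\<close>

text \<open>Only needed to show that the projective norm is definite on the algebraic tensor product.\<close>

definition sublinear :: "('a::real_vector \<Rightarrow> real) \<Rightarrow> bool" where
  "sublinear q \<longleftrightarrow> (\<forall>x y. q (x + y) \<le> q x + q y) \<and> (\<forall>c\<ge>0. \<forall>x. q (c *\<^sub>R x) = c * q x)"

lemma sublinear_lower:
  assumes "sublinear q"
  shows "- q (- x) \<le> q x"
proof -
  have "q (x + - x) \<le> q x + q (- x)" using assms unfolding sublinear_def by blast
  moreover have "q (0 *\<^sub>R x) = 0 * q x" using assms unfolding sublinear_def by blast
  ultimately show ?thesis by simp
qed

lemma sublinear_shift:
  fixes q :: "'a::real_vector \<Rightarrow> real"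
  assumes q: "sublinear q"
  obtains p where "sublinear p" "\<And>x t. t \<ge> 0 \<Longrightarrow> p x \<le> q (x + t *\<^sub>R y) - t * q y"
proof -
  define A where "A = (\<lambda>x t. q (x + t *\<^sub>R y) - t * q y)"
  define p where "p = (\<lambda>x. INF t\<in>{0..}. A x t)"
  have sub: "q (u + v) \<le> q u + q v" and hom: "c \<ge> 0 \<Longrightarrow> q (c *\<^sub>R u) = c * q u" for u v c
    using q by (auto simp: sublinear_def)
  have lb: "- q (- x) \<le> A x t" if "t \<ge> 0" for x t
    using sub[of "x + t *\<^sub>R y" "- x"] hom[OF that, of y] by (simp add: A_def)
  have le: "p x \<le> A x t" if "t \<ge> 0" for x t
    unfolding p_def using that lb by (intro cINF_lower bdd_belowI2[where m = "- q (- x)"]) auto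
  have ge: "m \<le> p x" if "\<And>t. t \<ge> 0 \<Longrightarrow> m \<le> A x t" for x m
    unfolding p_def using that by (intro cINF_greatest) auto
  have add: "p (x + x') \<le> p x + p x'" for x x'
  proof -
    have "p (x + x') - A x s \<le> A x' t" if "s \<ge> 0" "t \<ge> 0" for s t
      using le[of "s + t" "x + x'"] sub[of "x + s *\<^sub>R y" "x' + t *\<^sub>R y"] that
      by (simp add: A_def algebra_simps)
    then have "p (x + x') - A x s \<le> p x'" if "s \<ge> 0" for s using ge that by blast
    then have "p (x + x') - p x' \<le> A x s" if "s \<ge> 0" for s using that by (simp add: algebra_simps)
    then have "p (x + x') - p x' \<le> p x" using ge by blast
    then show ?thesis by simp
  qed
  have scale: "c * p x \<le> p (c *\<^sub>R x)" if c: "c > 0" for c x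
  proof (rule ge)
    fix t :: real assume t: "t \<ge> 0"
    have "A (c *\<^sub>R x) t = c * A x (t / c)"
      using hom[of c "x + (t / c) *\<^sub>R y"] c by (simp add: A_def algebra_simps)
    then show "c * p x \<le> A (c *\<^sub>R x) t" using le[of "t / c" x] c t by simp
  qed
  have "p (c *\<^sub>R x) = c * p x" if c: "c \<ge> 0" for c x
  proof (cases "c = 0")
    case True
    have "A 0 t = 0" if "t \<ge> 0" for t using hom[OF that, of y] by (simp add: A_def)
    then have "p 0 = 0" using le[of 0 0] ge[of 0 0] by force
    then show ?thesis using True by simp
  next
    case False
    then have "c > 0" using c by simp
    then have "p (c *\<^sub>R x) \<le> c * p x" using scale[of "1 / c" "c *\<^sub>R x"] by (simp add: field_simps)
    then show ?thesis using scale[OF \<open>c > 0\<close>, of x] by simp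
  qed
  with add have "sublinear p" by (simp add: sublinear_def)
  then show thesis using that le by (auto simp: A_def)
qed

lemma sublinear_minimal_linear:
  fixes q :: "'a::real_vector \<Rightarrow> real"
  assumes q: "sublinear q" and min: "\<And>p. sublinear p \<Longrightarrow> (\<And>x. p x \<le> q x) \<Longrightarrow> p = q"
  shows "linear q"
proof -
  have sub: "q (u + v) \<le> q u + q v" and hom: "c \<ge> 0 \<Longrightarrow> q (c *\<^sub>R u) = c * q u" for u v c
    using q by (auto simp: sublinear_def)
  have add: "q (x + y) = q x + q y" for x y
  proof -
    obtain p where p: "sublinear p" "\<And>x t. t \<ge> 0 \<Longrightarrow> p x \<le> q (x + t *\<^sub>R y) - t * q y"
      using sublinear_shift[OF q] by metis
    have "p x \<le> q x" for x using p(2)[of 0 x] by simp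
    then have "p = q" using min p(1) by blast
    then have "q x \<le> q (x + y) - q y" using p(2)[of 1 x] by simp
    then show ?thesis using sub[of x y] by simp
  qed
  have "q 0 = 0" using hom[of 0 0] by simp
  then have neg: "q (- x) = - q x" for x using add[of x "- x"] by simp
  have "q (c *\<^sub>R x) = c * q x" for c x
    using hom[of c x] hom[of "- c" x] neg[of "c *\<^sub>R x"] by (cases "c \<ge> 0") auto
  then show ?thesis using add by (simp add: linear_iff)
qed

lemma linear_below_sublinear:
  fixes r :: "'a::real_vector \<Rightarrow> real"
  assumes r: "sublinear r"
  obtains f where "linear f" "\<And>x. f x \<le> r x"
proof -
  define S where "S = {q. sublinear q \<and> (\<forall>x. q x \<le> r x)}"
  define P where "P = (\<lambda>(q::'a \<Rightarrow> real) q'. \<forall>x. q' x \<le> q x)"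
  have "\<exists>m\<in>S. \<forall>a\<in>S. P m a \<longrightarrow> a = m"
  proof (rule predicate_Zorn)
    show "partial_order_on S (relation_of P S)"
      by (rule partial_order_on_relation_ofI) (auto simp: P_def intro: order_trans intro!: ext antisym)
    fix C assume C: "C \<in> Chains (relation_of P S)"
    then have CS: "C \<subseteq> S" and tot: "\<And>p q. p \<in> C \<Longrightarrow> q \<in> C \<Longrightarrow> P p q \<or> P q p"
      by (auto simp: Chains_def relation_of_def)
    show "\<exists>u\<in>S. \<forall>a\<in>C. P a u"
    proof (cases "C = {}")
      case True
      then show ?thesis using r by (auto simp: S_def)
    next
      case False
      define u where "u = (\<lambda>x. INF q\<in>C. q x)"
      have lb: "- r (- x) \<le> q x" if "q \<in> C" for q x
      proof -
        have "sublinear q" "q (- x) \<le> r (- x)" using CS that by (auto simp: S_def)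
        then show ?thesis using sublinear_lower[of q x] by linarith
      qed
      have le: "u x \<le> q x" if "q \<in> C" for q x
        unfolding u_def using that lb by (intro cINF_lower bdd_belowI2[where m = "- r (- x)"]) auto
      have ge: "m \<le> u x" if "\<And>q. q \<in> C \<Longrightarrow> m \<le> q x" for m x
        unfolding u_def using that False by (intro cINF_greatest) auto
      have sub: "q (x + y) \<le> q x + q y" and hom: "c \<ge> 0 \<Longrightarrow> q (c *\<^sub>R x) = c * q x"
        if "q \<in> C" for q x y c
        using that CS by (auto simp: S_def sublinear_def)
      have add: "u (x + y) \<le> u x + u y" for x y
      proof -
        have "u (x + y) - p x \<le> q y" if "p \<in> C" "q \<in> C" for p q
        proof -
          have "P p q \<or> P q p" using tot that by blast
          then show ?thesis
          proof
            assume "P p q"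
            then have "q x \<le> p x" by (simp add: P_def)
            then show ?thesis using le[OF that(2), of "x + y"] sub[OF that(2), of x y] by linarith
          next
            assume "P q p"
            then have "p y \<le> q y" by (simp add: P_def)
            then show ?thesis using le[OF that(1), of "x + y"] sub[OF that(1), of x y] by linarith
          qed
        qed
        then have "u (x + y) - p x \<le> u y" if "p \<in> C" for p using ge that by blast
        then have "u (x + y) - u y \<le> p x" if "p \<in> C" for p using that by (simp add: algebra_simps)
        then have "u (x + y) - u y \<le> u x" using ge by blast
        then show ?thesis by simp
      qed
      have scale: "c * u x \<le> u (c *\<^sub>R x)" if c: "c \<ge> 0" for c x
      proof (rule ge)
        fix q assume "q \<in> C"
        then show "c * u x \<le> q (c *\<^sub>R x)"
          using hom[of q c x] le[of q x] c by (simp add: mult_left_mono)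
      qed
      have "u (c *\<^sub>R x) = c * u x" if c: "c \<ge> 0" for c x
      proof (cases "c = 0")
        case True
        have "q 0 = 0" if "q \<in> C" for q using hom[OF that, of 0 0] by simp
        then have "u 0 = 0" using le[of _ 0] ge[of 0 0] False by (force intro: antisym)
        then show ?thesis using True by simp
      next
        case False
        then have "c > 0" using c by simp
        then have "u (c *\<^sub>R x) \<le> c * u x" using scale[of "1 / c" "c *\<^sub>R x"] by (simp add: field_simps)
        then show ?thesis using scale[OF c, of x] by simp
      qed
      with add have "sublinear u" by (simp add: sublinear_def)
      moreover have "u x \<le> r x" for x
      proof -
        obtain q where "q \<in> C" using False by blast
        then have "q x \<le> r x" using CS by (auto simp: S_def)
        then show ?thesis using le[OF \<open>q \<in> C\<close>, of x] by linarith
      qed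
      ultimately show ?thesis using le by (auto simp: S_def P_def)
    qed
  qed
  then obtain m where m: "m \<in> S" "\<And>a. a \<in> S \<Longrightarrow> P m a \<Longrightarrow> a = m" by blast
  have mr: "sublinear m" "\<And>x. m x \<le> r x" using m(1) by (auto simp: S_def)
  have "linear m"
  proof (rule sublinear_minimal_linear[OF mr(1)])
    fix p assume p: "sublinear p" "\<And>x. p x \<le> m x"
    have "p \<in> S" using p mr(2) order_trans unfolding S_def by blast
    then show "p = m" using m(2) p(2) by (simp add: P_def)
  qed
  then show thesis using that mr(2) by blast
qed

lemma norming_functional:
  fixes a :: "'a::real_normed_vector"
  obtains f where "linear f" "\<And>x. \<bar>f x\<bar> \<le> norm x" "f a = norm a"
proof -
  have "sublinear (norm :: 'a \<Rightarrow> real)" by (simp add: sublinear_def norm_triangle_ineq)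
  then obtain p where p: "sublinear p" "\<And>x t. t \<ge> 0 \<Longrightarrow> p x \<le> norm (x + t *\<^sub>R a) - t * norm a"
    using sublinear_shift by metis
  obtain f where f: "linear f" "\<And>x. f x \<le> p x" using linear_below_sublinear[OF p(1)] by blast
  have neg: "f (- x) = - f x" for x using f(1) by (rule linear_neg)
  have le: "f x \<le> norm x" for x using f(2)[of x] p(2)[of 0 x] by simp
  have abs: "\<bar>f x\<bar> \<le> norm x" for x using le[of x] le[of "- x"] neg[of x] by (simp add: abs_le_iff)
  have "f (- a) \<le> - norm a" using f(2)[of "- a"] p(2)[of 1 "- a"] by simp
  then have "f a = norm a" using neg[of a] le[of a] by simp
  then show thesis using that f(1) abs by blast
qed

section \<open>The algebraic tensor product with the projective norm\<close>

text \<open>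
  The algebraic tensor product \<open>X \<otimes> Y\<close> is realised inside the dual of the space of bilinear
  forms on \<open>X \<times> Y\<close>: \<open>x \<otimes> y\<close> is evaluation at \<open>(x, y)\<close>, and a general tensor is a finite sum
  \<open>\<Sum>i x\<^sub>i \<otimes> y\<^sub>i\<close>, given here by the list of its pairs (scalars are absorbed in the \<open>x\<^sub>i\<close>). The
  value \<open>0\<close> at non-bilinear arguments only makes the functional total.
\<close>

definition eval_pairs :: "('a \<times> 'b) list \<Rightarrow> ('a::real_vector \<Rightarrow> 'b::real_vector \<Rightarrow> real) \<Rightarrow> real" where
  "eval_pairs ps B = (if bilinear B then \<Sum>(x, y)\<leftarrow>ps. B x y else 0)"

typedef (overloaded) ('a::real_vector, 'b::real_vector) tensor =
  "range (eval_pairs :: ('a \<times> 'b) list \<Rightarrow> ('a \<Rightarrow> 'b \<Rightarrow> real) \<Rightarrow> real)"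
  by blast

setup_lifting type_definition_tensor

lift_definition tensor :: "'a::real_vector \<Rightarrow> 'b::real_vector \<Rightarrow> ('a, 'b) tensor" (infixl "\<otimes>" 72)
  is "\<lambda>x y. eval_pairs [(x, y)]"
  by blast

lemma eval_pairs_Nil: "eval_pairs [] = (\<lambda>B. 0)"
  by (simp add: eval_pairs_def fun_eq_iff)

lemma eval_pairs_append: "eval_pairs (ps @ qs) = (\<lambda>B. eval_pairs ps B + eval_pairs qs B)"
  by (simp add: eval_pairs_def fun_eq_iff)

lemma eval_pairs_scale:
  "eval_pairs (map (\<lambda>(x, y). (c *\<^sub>R x, y)) ps) = (\<lambda>B. c * eval_pairs ps B)"
proof
  fix B :: "'a \<Rightarrow> 'b \<Rightarrow> real"
  have "(\<Sum>(x, y)\<leftarrow>map (\<lambda>(x, y). (c *\<^sub>R x, y)) ps. B x y) = c * (\<Sum>(x, y)\<leftarrow>ps. B x y)" if "bilinear B"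
    using that by (induction ps) (auto simp: bilinear_lmul algebra_simps)
  then show "eval_pairs (map (\<lambda>(x, y). (c *\<^sub>R x, y)) ps) B = c * eval_pairs ps B"
    by (simp add: eval_pairs_def del: map_map)
qed

instantiation tensor :: (real_vector, real_vector) real_vector
begin

lift_definition zero_tensor :: "('a, 'b) tensor" is "\<lambda>B. 0"
  by (rule range_eqI[of _ _ "[]"]) (simp add: eval_pairs_Nil)

lift_definition plus_tensor :: "('a, 'b) tensor \<Rightarrow> ('a, 'b) tensor \<Rightarrow> ('a, 'b) tensor"
  is "\<lambda>u v B. u B + v B"
  by (force simp flip: eval_pairs_append)

lift_definition scaleR_tensor :: "real \<Rightarrow> ('a, 'b) tensor \<Rightarrow> ('a, 'b) tensor"
  is "\<lambda>c u B. c * u B"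
  by (force simp flip: eval_pairs_scale)

definition uminus_tensor :: "('a, 'b) tensor \<Rightarrow> ('a, 'b) tensor" where
  "uminus_tensor u = (-1) *\<^sub>R u"

definition minus_tensor :: "('a, 'b) tensor \<Rightarrow> ('a, 'b) tensor \<Rightarrow> ('a, 'b) tensor" where
  "minus_tensor u v = u + - v"

instance
  by standard
    (unfold minus_tensor_def uminus_tensor_def, (transfer; simp add: fun_eq_iff algebra_simps)+)

end

lemma bilinear_tensor: "bilinear (\<otimes>)"
  unfolding bilinear_def linear_iff
  by (intro allI conjI; transfer)
    (auto simp: eval_pairs_def fun_eq_iff bilinear_ladd bilinear_radd bilinear_lmul bilinear_rmul)

lemma Rep_sum_tensor: "Rep_tensor (\<Sum>(x, y)\<leftarrow>ps. x \<otimes> y) = eval_pairs ps"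
  by (induction ps)
    (auto simp: zero_tensor.rep_eq plus_tensor.rep_eq tensor.rep_eq eval_pairs_def fun_eq_iff)

lemma tensor_cases: obtains ps where "z = (\<Sum>(x, y)\<leftarrow>ps. x \<otimes> y)"
  using Rep_tensor[of z] by (auto simp flip: Rep_sum_tensor simp: Rep_tensor_inject)

lemma sum_tensor_eq_iff:
  "(\<Sum>(x, y)\<leftarrow>ps. x \<otimes> y) = (\<Sum>(x, y)\<leftarrow>qs. x \<otimes> y) \<longleftrightarrow>
    (\<forall>B. bilinear B \<longrightarrow> (\<Sum>(x, y)\<leftarrow>ps. B x y) = (\<Sum>(x, y)\<leftarrow>qs. B x y :: real))"
  by (auto simp: Rep_sum_tensor eval_pairs_def fun_eq_iff simp flip: Rep_tensor_inject)

lemma sum_tensor_eq_0_iff: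
  "(\<Sum>(x, y)\<leftarrow>ps. x \<otimes> y) = 0 \<longleftrightarrow> (\<forall>B. bilinear B \<longrightarrow> (\<Sum>(x, y)\<leftarrow>ps. B x y :: real) = 0)"
  using sum_tensor_eq_iff[of ps "[]"] by simp

lemma sum_tensor_eq_0I:
  fixes ps :: "('a::real_normed_vector \<times> 'b::real_normed_vector) list"
  assumes "\<And>\<phi> \<psi>. bounded_linear \<phi> \<Longrightarrow> bounded_linear \<psi> \<Longrightarrow> (\<Sum>(x, y)\<leftarrow>ps. \<phi> x * \<psi> y :: real) = 0"
  shows "(\<Sum>(x, y)\<leftarrow>ps. x \<otimes> y) = 0"
proof -
  have "(\<Sum>(x, y)\<leftarrow>ps. B x y) = 0" if B: "bilinear B" for B :: "'a \<Rightarrow> 'b \<Rightarrow> real"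
    using assms
  proof (induction "length ps" arbitrary: ps)
    case 0
    then show ?case by simp
  next
    case (Suc n)
    then obtain a b qs where ps: "ps = (a, b) # qs" by (cases ps) auto
    show ?case
    proof (cases "b = 0")
      case True
      have "(\<Sum>(x, y)\<leftarrow>qs. \<phi> x * \<psi> y) = 0" if "bounded_linear \<phi>" "bounded_linear \<psi>"
        for \<phi> :: "'a \<Rightarrow> real" and \<psi> :: "'b \<Rightarrow> real"
        using Suc(3)[OF that] ps True linear_simps(3)[OF that(2)] by simp
      then have "(\<Sum>(x, y)\<leftarrow>qs. B x y) = 0" using Suc(1)[of qs] Suc(2) ps by simp
      then show ?thesis using ps True bilinear_rzero[OF B] by simp
    next
      case False
      obtain f where f: "linear f" "\<And>x. \<bar>f x\<bar> \<le> norm x" "f b = norm b"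
        using norming_functional[of b] by blast
      define \<psi>0 where "\<psi>0 = (\<lambda>y. f y / norm b)"
      have "bounded_linear f"
        using f(1,2) by (auto simp: bounded_linear_def bounded_linear_axioms_def intro!: exI[of _ 1])
      then have \<psi>0: "bounded_linear \<psi>0" unfolding \<psi>0_def by (rule bounded_linear_divide[THEN bounded_linear_compose])
      have \<psi>0b: "\<psi>0 b = 1" using False f(3) by (simp add: \<psi>0_def)
      have a: "a = - (\<Sum>(x, y)\<leftarrow>qs. \<psi>0 y *\<^sub>R x)"
      proof (rule ccontr)
        define d where "d = a + (\<Sum>(x, y)\<leftarrow>qs. \<psi>0 y *\<^sub>R x)"
        assume "a \<noteq> - (\<Sum>(x, y)\<leftarrow>qs. \<psi>0 y *\<^sub>R x)"
        then have "d \<noteq> 0" unfolding d_def by (metis add_eq_0_iff2)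
        obtain \<phi> where \<phi>: "linear \<phi>" "\<And>x. \<bar>\<phi> x\<bar> \<le> norm x" "\<phi> d = norm d"
          using norming_functional[of d] by blast
        have b\<phi>: "bounded_linear \<phi>"
          using \<phi>(1,2) by (auto simp: bounded_linear_def bounded_linear_axioms_def intro!: exI[of _ 1])
        have "\<phi> (\<Sum>(x, y)\<leftarrow>qs. \<psi>0 y *\<^sub>R x) = (\<Sum>(x, y)\<leftarrow>qs. \<phi> x * \<psi>0 y)"
          by (induction qs) (auto simp: linear_0[OF \<phi>(1)] linear_add[OF \<phi>(1)] linear_scale[OF \<phi>(1)])
        then have "\<phi> d = (\<Sum>(x, y)\<leftarrow>ps. \<phi> x * \<psi>0 y)"
          using ps \<psi>0b by (simp add: d_def linear_add[OF \<phi>(1)])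
        then show False using Suc(3)[OF b\<phi> \<psi>0] \<phi>(3) \<open>d \<noteq> 0\<close> by simp
      qed
      define rs where "rs = map (\<lambda>(x, y). (x, y - \<psi>0 y *\<^sub>R b)) qs"
      have "(\<Sum>(x, y)\<leftarrow>ps. C x y) = (\<Sum>(x, y)\<leftarrow>rs. C x y)" if C: "bilinear C" for C :: "'a \<Rightarrow> 'b \<Rightarrow> real"
      proof -
        have "C (\<Sum>(x, y)\<leftarrow>qs. \<psi>0 y *\<^sub>R x) b = (\<Sum>(x, y)\<leftarrow>qs. \<psi>0 y * C x b)"
          by (induction qs) (auto simp: bilinear_lzero[OF C] bilinear_ladd[OF C] bilinear_lmul[OF C])
        then have "C a b = - (\<Sum>(x, y)\<leftarrow>qs. \<psi>0 y * C x b)"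
          by (subst a) (simp add: bilinear_lneg[OF C])
        moreover have "(\<Sum>(x, y)\<leftarrow>rs. C x y) = (\<Sum>(x, y)\<leftarrow>qs. C x y) - (\<Sum>(x, y)\<leftarrow>qs. \<psi>0 y * C x b)"
          unfolding rs_def
          by (induction qs) (auto simp: bilinear_rsub[OF C] bilinear_rmul[OF C])
        ultimately show ?thesis using ps by simp
      qed
      note eq = this
      have "(\<Sum>(x, y)\<leftarrow>rs. \<phi> x * \<psi> y) = 0" if b: "bounded_linear \<phi>" "bounded_linear \<psi>"
        for \<phi> :: "'a \<Rightarrow> real" and \<psi> :: "'b \<Rightarrow> real"
      proof -
        have "bilinear (\<lambda>x y. \<phi> x * \<psi> y)"
          using b[THEN bounded_linear.linear] by (auto simp: bilinear_def linear_iff algebra_simps)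
        then show ?thesis using eq[of "\<lambda>x y. \<phi> x * \<psi> y"] Suc(3)[OF b] by simp
      qed
      then have "(\<Sum>(x, y)\<leftarrow>rs. B x y) = 0" using Suc(1)[of rs] Suc(2) ps by (simp add: rs_def)
      then show ?thesis using eq[OF B] by simp
    qed
  qed
  then show ?thesis using sum_tensor_eq_0_iff by blast
qed

instantiation tensor :: (real_normed_vector, real_normed_vector) real_normed_vector
begin

definition norm_tensor :: "('a, 'b) tensor \<Rightarrow> real" where
  "norm_tensor z = Inf {(\<Sum>(x, y)\<leftarrow>ps. norm x * norm y) |ps. z = (\<Sum>(x, y)\<leftarrow>ps. x \<otimes> y)}"

definition dist_tensor :: "('a, 'b) tensor \<Rightarrow> ('a, 'b) tensor \<Rightarrow> real" where
  "dist_tensor z w = norm (z - w)"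

definition sgn_tensor :: "('a, 'b) tensor \<Rightarrow> ('a, 'b) tensor" where
  "sgn_tensor z = z /\<^sub>R norm z"

definition uniformity_tensor :: "(('a, 'b) tensor \<times> ('a, 'b) tensor) filter" where
  "uniformity_tensor = (INF e\<in>{0<..}. principal {(z, w). dist z w < e})"

definition open_tensor :: "('a, 'b) tensor set \<Rightarrow> bool" where
  "open_tensor U = (\<forall>z\<in>U. \<forall>\<^sub>F (z', w) in uniformity. z' = z \<longrightarrow> w \<in> U)"

instance
proof
  have cost_nonneg: "(\<Sum>(x, y)\<leftarrow>ps. norm x * norm y) \<ge> 0" for ps :: "('a \<times> 'b) list"
    by (induction ps) auto
  have lower: "norm z \<le> (\<Sum>(x, y)\<leftarrow>ps. norm x * norm y)"
    if "z = (\<Sum>(x, y)\<leftarrow>ps. x \<otimes> y)" for z :: "('a, 'b) tensor" and ps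
    unfolding norm_tensor_def using that cost_nonneg by (intro cInf_lower bdd_belowI[of _ 0]) blast+
  have greatest: "m \<le> norm z"
    if "\<And>ps. z = (\<Sum>(x, y)\<leftarrow>ps. x \<otimes> y) \<Longrightarrow> m \<le> (\<Sum>(x, y)\<leftarrow>ps. norm x * norm y)"
    for z :: "('a, 'b) tensor" and m
    unfolding norm_tensor_def by (rule cInf_greatest) (use that tensor_cases[of z] in blast)+
  have nonneg: "norm z \<ge> 0" for z :: "('a, 'b) tensor"
    using greatest cost_nonneg by blast
  have scale: "\<bar>c\<bar> * norm z \<ge> norm (c *\<^sub>R z)" for c and z :: "('a, 'b) tensor"
  proof (cases "c = 0")
    case True
    then show ?thesis using lower[of 0 "[]"] by simp
  next
    case False
    have "norm (c *\<^sub>R z) / \<bar>c\<bar> \<le> norm z"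
    proof (rule greatest)
      fix ps assume z: "z = (\<Sum>(x, y)\<leftarrow>ps. x \<otimes> y)"
      define qs where "qs = map (\<lambda>(x, y). (c *\<^sub>R x, y)) ps"
      have "c *\<^sub>R z = (\<Sum>(x, y)\<leftarrow>qs. x \<otimes> y)"
        unfolding z qs_def
        by (induction ps) (auto simp: bilinear_lmul[OF bilinear_tensor] scaleR_add_right)
      moreover have "(\<Sum>(x, y)\<leftarrow>qs. norm x * norm y) = \<bar>c\<bar> * (\<Sum>(x, y)\<leftarrow>ps. norm x * norm y)"
        unfolding qs_def by (induction ps) (auto simp: algebra_simps)
      ultimately show "norm (c *\<^sub>R z) / \<bar>c\<bar> \<le> (\<Sum>(x, y)\<leftarrow>ps. norm x * norm y)"
        using lower[of "c *\<^sub>R z" qs] False by (simp add: field_simps)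
    qed
    then show ?thesis using False by (simp add: field_simps)
  qed
  fix z w :: "('a, 'b) tensor" and c :: real and U :: "('a, 'b) tensor set"
  show "dist z w = norm (z - w)" by (rule dist_tensor_def)
  show "sgn z = inverse (norm z) *\<^sub>R z" by (rule sgn_tensor_def)
  show "uniformity = (INF e\<in>{0<..}. principal {(z, w :: ('a, 'b) tensor). dist z w < e})"
    by (rule uniformity_tensor_def)
  show "open U = (\<forall>z\<in>U. \<forall>\<^sub>F (z', w) in uniformity. z' = z \<longrightarrow> w \<in> U)" by (rule open_tensor_def)
  show "norm (z + w) \<le> norm z + norm w"
  proof -
    have "norm (z + w) - (\<Sum>(x, y)\<leftarrow>ps. norm x * norm y) \<le> norm w"
      if "z = (\<Sum>(x, y)\<leftarrow>ps. x \<otimes> y)" for ps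
    proof (rule greatest)
      fix qs assume "w = (\<Sum>(x, y)\<leftarrow>qs. x \<otimes> y)"
      then show "norm (z + w) - (\<Sum>(x, y)\<leftarrow>ps. norm x * norm y) \<le> (\<Sum>(x, y)\<leftarrow>qs. norm x * norm y)"
        using lower[of "z + w" "ps @ qs"] that by simp
    qed
    then have "norm (z + w) - norm w \<le> norm z" by (intro greatest) (force simp: algebra_simps)
    then show ?thesis by simp
  qed
  show "norm (c *\<^sub>R z) = \<bar>c\<bar> * norm z"
  proof (cases "c = 0")
    case True
    then show ?thesis using lower[of 0 "[]"] nonneg[of 0] by simp
  next
    case False
    then have "\<bar>c\<bar> * norm z \<le> norm (c *\<^sub>R z)"
      using scale[of "1 / c" "c *\<^sub>R z"] by (simp add: field_simps)
    then show ?thesis using scale[of c z] by simp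
  qed
  show "norm z = 0 \<longleftrightarrow> z = 0"
  proof
    assume "z = 0"
    then show "norm z = 0" using lower[of 0 "[]"] nonneg[of 0] by simp
  next
    assume z0: "norm z = 0"
    obtain ps where z: "z = (\<Sum>(x, y)\<leftarrow>ps. x \<otimes> y)" by (rule tensor_cases)
    have "(\<Sum>(x, y)\<leftarrow>ps. \<phi> x * \<psi> y) = 0" if b: "bounded_linear \<phi>" "bounded_linear \<psi>"
      for \<phi> :: "'a \<Rightarrow> real" and \<psi> :: "'b \<Rightarrow> real"
    proof -
      obtain K where K: "K > 0" "\<And>x. norm (\<phi> x) \<le> norm x * K"
        using bounded_linear.pos_bounded[OF b(1)] by blast
      obtain L where L: "L > 0" "\<And>y. norm (\<psi> y) \<le> norm y * L"
        using bounded_linear.pos_bounded[OF b(2)] by blast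
      have bil: "bilinear (\<lambda>x y. \<phi> x * \<psi> y)"
        using b[THEN bounded_linear.linear] by (auto simp: bilinear_def linear_iff algebra_simps)
      define s where "s = (\<Sum>(x, y)\<leftarrow>ps. \<phi> x * \<psi> y)"
      have "\<bar>s\<bar> / (K * L) \<le> norm z"
      proof (rule greatest)
        fix qs assume "z = (\<Sum>(x, y)\<leftarrow>qs. x \<otimes> y)"
        then have "\<forall>B. bilinear B \<longrightarrow> (\<Sum>(x, y)\<leftarrow>ps. B x y :: real) = (\<Sum>(x, y)\<leftarrow>qs. B x y)"
          using z sum_tensor_eq_iff[of ps qs] by simp
        from this[rule_format, OF bil] have "s = (\<Sum>(x, y)\<leftarrow>qs. \<phi> x * \<psi> y)"
          by (simp add: s_def)
        also have "\<bar>\<dots>\<bar> \<le> K * L * (\<Sum>(x, y)\<leftarrow>qs. norm x * norm y)"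
        proof (induction qs)
          case (Cons p qs)
          obtain x y where p: "p = (x, y)" by force
          have "\<bar>\<phi> x * \<psi> y\<bar> \<le> (norm x * K) * (norm y * L)"
            using K(2)[of x] L(2)[of y] K(1) by (simp add: abs_mult mult_mono)
          then show ?case using Cons p by (simp add: algebra_simps)
        qed simp
        finally show "\<bar>s\<bar> / (K * L) \<le> (\<Sum>(x, y)\<leftarrow>qs. norm x * norm y)"
          using K(1) L(1) by (simp add: field_simps)
      qed
      then show ?thesis using z0 K(1) L(1) by (simp add: s_def field_simps zero_less_mult_iff)
    qed
    then show "z = 0" unfolding z by (rule sum_tensor_eq_0I)
  qed
qed

end

section \<open>Completion of a normed space\<close>

definition cauchy_rel :: "(nat \<Rightarrow> 'a::real_normed_vector) \<Rightarrow> (nat \<Rightarrow> 'a) \<Rightarrow> bool" where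
  "cauchy_rel X Y \<longleftrightarrow> Cauchy X \<and> Cauchy Y \<and> (\<lambda>n. X n - Y n) \<longlonglongrightarrow> 0"

lemma cauchy_rel_refl: "Cauchy X \<Longrightarrow> cauchy_rel X X"
  by (simp add: cauchy_rel_def)

lemma cauchy_rel_const: "cauchy_rel (\<lambda>n. x) (\<lambda>n. x)"
  by (rule cauchy_rel_refl[OF LIMSEQ_imp_Cauchy[OF tendsto_const]])

lemma part_equivp_cauchy_rel: "part_equivp cauchy_rel"
proof (rule part_equivpI)
  show "\<exists>X::nat \<Rightarrow> 'a. cauchy_rel X X" using cauchy_rel_const by blast
  show "symp (cauchy_rel :: (nat \<Rightarrow> 'a) \<Rightarrow> _)"
  proof (rule sympI)
    fix X Y :: "nat \<Rightarrow> 'a" assume "cauchy_rel X Y"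
    then show "cauchy_rel Y X" using tendsto_minus[of "\<lambda>n. X n - Y n" 0] by (simp add: cauchy_rel_def)
  qed
  show "transp (cauchy_rel :: (nat \<Rightarrow> 'a) \<Rightarrow> _)"
  proof (rule transpI)
    fix X Y W :: "nat \<Rightarrow> 'a" assume "cauchy_rel X Y" "cauchy_rel Y W"
    then show "cauchy_rel X W"
      using tendsto_add[of "\<lambda>n. X n - Y n" 0 _ "\<lambda>n. Y n - W n" 0] by (simp add: cauchy_rel_def)
  qed
qed

text \<open>The completion of a normed space: Cauchy sequences modulo null sequences.\<close>

quotient_type (overloaded) 'a completion = "nat \<Rightarrow> 'a::real_normed_vector" / partial: cauchy_rel
  by (rule part_equivp_cauchy_rel)

lemma Cauchy_norm:
  fixes X :: "nat \<Rightarrow> 'a::real_normed_vector"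
  assumes "Cauchy X"
  shows "Cauchy (\<lambda>n. norm (X n))"
proof (rule metric_CauchyI)
  fix e :: real assume "e > 0"
  then obtain M where M: "\<And>m n. m \<ge> M \<Longrightarrow> n \<ge> M \<Longrightarrow> dist (X m) (X n) < e"
    using assms unfolding Cauchy_def by blast
  have "dist (norm (X m)) (norm (X n)) < e" if "m \<ge> M" "n \<ge> M" for m n
    using M[OF that] norm_triangle_ineq3[of "X m" "X n"] by (simp add: dist_norm)
  then show "\<exists>M. \<forall>m\<ge>M. \<forall>n\<ge>M. dist (norm (X m)) (norm (X n)) < e" by blast
qed

lemma Cauchy_scaleR:
  fixes X :: "nat \<Rightarrow> 'a::real_normed_vector"
  shows "Cauchy X \<Longrightarrow> Cauchy (\<lambda>n. c *\<^sub>R X n)"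
  by (rule bounded_linear.Cauchy[OF bounded_linear_scaleR_right])

lemma Cauchy_add_seq:
  fixes X Y :: "nat \<Rightarrow> 'a::real_normed_vector"
  assumes "Cauchy X" "Cauchy Y"
  shows "Cauchy (\<lambda>n. X n + Y n)"
proof (rule CauchyI)
  fix e :: real assume "e > 0"
  then have "e / 2 > 0" by simp
  obtain M where M: "\<And>m n. m \<ge> M \<Longrightarrow> n \<ge> M \<Longrightarrow> norm (X m - X n) < e / 2"
    using CauchyD[OF assms(1) \<open>e / 2 > 0\<close>] by blast
  obtain N where N: "\<And>m n. m \<ge> N \<Longrightarrow> n \<ge> N \<Longrightarrow> norm (Y m - Y n) < e / 2"
    using CauchyD[OF assms(2) \<open>e / 2 > 0\<close>] by blast
  have "norm ((X m + Y m) - (X n + Y n)) < e" if "m \<ge> max M N" "n \<ge> max M N" for m n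
  proof -
    have "norm ((X m + Y m) - (X n + Y n)) \<le> norm (X m - X n) + norm (Y m - Y n)"
      by (rule norm_diff_triangle_ineq)
    then show ?thesis using M[of m n] N[of m n] that by simp
  qed
  then show "\<exists>M. \<forall>m\<ge>M. \<forall>n\<ge>M. norm ((X m + Y m) - (X n + Y n)) < e" by blast
qed

instantiation completion :: (real_normed_vector) real_normed_vector
begin

lift_definition zero_completion :: "'a completion" is "\<lambda>n. 0"
  by (rule cauchy_rel_const)

lift_definition plus_completion :: "'a completion \<Rightarrow> 'a completion \<Rightarrow> 'a completion"
  is "\<lambda>X Y n. X n + Y n"
proof -
  fix X X' Y Y' :: "nat \<Rightarrow> 'a" assume "cauchy_rel X X'" "cauchy_rel Y Y'"
  then show "cauchy_rel (\<lambda>n. X n + Y n) (\<lambda>n. X' n + Y' n)"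
    using tendsto_add[of "\<lambda>n. X n - X' n" 0 _ "\<lambda>n. Y n - Y' n" 0]
    by (simp add: cauchy_rel_def Cauchy_add_seq add_diff_add)
qed

lift_definition scaleR_completion :: "real \<Rightarrow> 'a completion \<Rightarrow> 'a completion"
  is "\<lambda>c X n. c *\<^sub>R X n"
proof -
  fix c and X Y :: "nat \<Rightarrow> 'a" assume "cauchy_rel X Y"
  then show "cauchy_rel (\<lambda>n. c *\<^sub>R X n) (\<lambda>n. c *\<^sub>R Y n)"
    using tendsto_scaleR[OF tendsto_const, of "\<lambda>n. X n - Y n" 0 _ c]
    by (simp add: cauchy_rel_def Cauchy_scaleR scaleR_diff_right)
qed

definition uminus_completion :: "'a completion \<Rightarrow> 'a completion" where
  "uminus_completion z = (-1) *\<^sub>R z"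

definition minus_completion :: "'a completion \<Rightarrow> 'a completion \<Rightarrow> 'a completion" where
  "minus_completion z w = z + - w"

lift_definition norm_completion :: "'a completion \<Rightarrow> real" is "\<lambda>X. lim (\<lambda>n. norm (X n))"
proof -
  fix X Y :: "nat \<Rightarrow> 'a" assume XY: "cauchy_rel X Y"
  then have "convergent (\<lambda>n. norm (Y n))"
    by (simp add: cauchy_rel_def Cauchy_convergent Cauchy_norm)
  then have Y: "(\<lambda>n. norm (Y n)) \<longlonglongrightarrow> lim (\<lambda>n. norm (Y n))" by (simp add: convergent_LIMSEQ_iff)
  have "(\<lambda>n. norm (X n - Y n)) \<longlonglongrightarrow> 0" using XY by (simp add: cauchy_rel_def tendsto_norm_zero)
  then have "(\<lambda>n. norm (X n) - norm (Y n)) \<longlonglongrightarrow> 0"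
    by (rule Lim_null_comparison[rotated]) (simp add: norm_triangle_ineq3)
  from tendsto_add[OF this Y] have "(\<lambda>n. norm (X n)) \<longlonglongrightarrow> lim (\<lambda>n. norm (Y n))" by simp
  then show "lim (\<lambda>n. norm (X n)) = lim (\<lambda>n. norm (Y n))" by (rule limI)
qed

definition dist_completion :: "'a completion \<Rightarrow> 'a completion \<Rightarrow> real" where
  "dist_completion z w = norm (z - w)"

definition sgn_completion :: "'a completion \<Rightarrow> 'a completion" where
  "sgn_completion z = inverse (norm z) *\<^sub>R z"

definition uniformity_completion :: "('a completion \<times> 'a completion) filter" where
  "uniformity_completion = (INF e\<in>{0<..}. principal {(z, w). dist z w < e})"

definition open_completion :: "'a completion set \<Rightarrow> bool" where
  "open_completion U = (\<forall>z\<in>U. \<forall>\<^sub>F (z', w) in uniformity. z' = z \<longrightarrow> w \<in> U)"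

instance
proof
  have lim: "(\<lambda>n. norm (X n)) \<longlonglongrightarrow> lim (\<lambda>n. norm (X n))" if "cauchy_rel X X" for X :: "nat \<Rightarrow> 'a"
    using that by (simp add: cauchy_rel_def Cauchy_convergent Cauchy_norm flip: convergent_LIMSEQ_iff)
  have eq: "cauchy_rel X Y" if "cauchy_rel X X" "cauchy_rel Y Y" "\<And>n. X n = Y n" for X Y :: "nat \<Rightarrow> 'a"
    using that by (simp add: cauchy_rel_def)
  have plus: "cauchy_rel (\<lambda>n. X n + Y n) (\<lambda>n. X n + Y n)" if "cauchy_rel X X" "cauchy_rel Y Y" for X Y :: "nat \<Rightarrow> 'a"
    using that by (simp add: cauchy_rel_def Cauchy_add_seq)
  have scale: "cauchy_rel (\<lambda>n. c *\<^sub>R X n) (\<lambda>n. c *\<^sub>R X n)" if "cauchy_rel X X" for c and X :: "nat \<Rightarrow> 'a"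
    using that by (simp add: cauchy_rel_def Cauchy_scaleR)
  have zero: "cauchy_rel (\<lambda>n. 0) (\<lambda>n. 0 :: 'a)"
    by (rule cauchy_rel_const)
  fix a b c :: "'a completion" and r s :: real and U :: "'a completion set"
  show "a + b + c = a + (b + c)"
    by transfer (rule eq; (intro zero plus scale; assumption)?; simp add: algebra_simps)
  show "a + b = b + a"
    by transfer (rule eq; (intro zero plus scale; assumption)?; simp add: algebra_simps)
  show "0 + a = a"
    by transfer (rule eq; (intro zero plus scale; assumption)?; simp add: algebra_simps)
  show "- a + a = 0"
    unfolding uminus_completion_def by transfer (rule eq; (intro zero plus scale; assumption)?; simp add: algebra_simps)
  show "a - b = a + - b" by (rule minus_completion_def)
  show "r *\<^sub>R (a + b) = r *\<^sub>R a + r *\<^sub>R b"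
    by transfer (rule eq; (intro zero plus scale; assumption)?; simp add: algebra_simps)
  show "(r + s) *\<^sub>R a = r *\<^sub>R a + s *\<^sub>R a"
    by transfer (rule eq; (intro zero plus scale; assumption)?; simp add: algebra_simps)
  show "r *\<^sub>R s *\<^sub>R a = (r * s) *\<^sub>R a"
    by transfer (rule eq; (intro zero plus scale; assumption)?; simp add: algebra_simps)
  show "1 *\<^sub>R a = a"
    by transfer (simp add: cauchy_rel_def)
  show "dist a b = norm (a - b)" by (rule dist_completion_def)
  show "sgn a = inverse (norm a) *\<^sub>R a" by (rule sgn_completion_def)
  show "uniformity = (INF e\<in>{0<..}. principal {(a, b :: 'a completion). dist a b < e})"
    by (rule uniformity_completion_def)
  show "open U = (\<forall>z\<in>U. \<forall>\<^sub>F (z', w) in uniformity. z' = z \<longrightarrow> w \<in> U)" by (rule open_completion_def)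
  show "norm a = 0 \<longleftrightarrow> a = 0"
  proof transfer
    fix X :: "nat \<Rightarrow> 'a" assume X: "cauchy_rel X X"
    have "lim (\<lambda>n. norm (X n)) = 0 \<longleftrightarrow> (\<lambda>n. norm (X n)) \<longlonglongrightarrow> 0"
      using lim[OF X] limI by metis
    also have "\<dots> \<longleftrightarrow> X \<longlonglongrightarrow> 0" by (rule tendsto_norm_zero_iff)
    also have "\<dots> \<longleftrightarrow> cauchy_rel X (\<lambda>n. 0)" using X zero by (simp add: cauchy_rel_def)
    finally show "lim (\<lambda>n. norm (X n)) = 0 \<longleftrightarrow> cauchy_rel X (\<lambda>n. 0)" .
  qed
  show "norm (a + b) \<le> norm a + norm b"
  proof transfer
    fix X Y :: "nat \<Rightarrow> 'a" assume XY: "cauchy_rel X X" "cauchy_rel Y Y"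
    show "lim (\<lambda>n. norm (X n + Y n)) \<le> lim (\<lambda>n. norm (X n)) + lim (\<lambda>n. norm (Y n))"
      by (rule LIMSEQ_le[OF lim[OF plus[OF XY]] tendsto_add[OF lim[OF XY(1)] lim[OF XY(2)]]])
        (simp add: norm_triangle_ineq)
  qed
  show "norm (r *\<^sub>R a) = \<bar>r\<bar> * norm a"
  proof transfer
    fix r and X :: "nat \<Rightarrow> 'a" assume X: "cauchy_rel X X"
    show "lim (\<lambda>n. norm (r *\<^sub>R X n)) = \<bar>r\<bar> * lim (\<lambda>n. norm (X n))"
      unfolding norm_scaleR by (rule limI[OF tendsto_mult[OF tendsto_const lim[OF X]]])
  qed
qed

end

lift_definition to_completion :: "'a::real_normed_vector \<Rightarrow> 'a completion" is "\<lambda>x n. x"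
  by (rule cauchy_rel_const)

lemma norm_to_completion: "norm (to_completion x) = norm x"
  by transfer (rule limI[OF tendsto_const])

lemma linear_to_completion: "linear to_completion"
  unfolding linear_iff
  by (intro conjI allI; transfer) (simp_all add: cauchy_rel_const)

lemma norm_completion_seq:
  assumes "Cauchy X"
  shows "(\<lambda>n. norm (X n - x)) \<longlonglongrightarrow> norm (abs_completion X - to_completion x)"
proof -
  have X: "cauchy_rel X X" using assms by (rule cauchy_rel_refl)
  have C: "cauchy_rel (\<lambda>n. - x) (\<lambda>n. - x)" by (rule cauchy_rel_const)
  have "Cauchy (\<lambda>n. X n + - x)" using assms C by (intro Cauchy_add_seq) (auto simp: cauchy_rel_def)
  moreover have "abs_completion X - to_completion x = abs_completion (\<lambda>n. X n + - x)"
    unfolding diff_conv_add_uminus linear_neg[OF linear_to_completion, symmetric]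
    by (simp add: plus_completion.abs_eq[OF X C] to_completion_def)
  ultimately have "norm (abs_completion X - to_completion x) = lim (\<lambda>n. norm (X n + - x))"
    and "convergent (\<lambda>n. norm (X n + - x))"
    by (simp_all only: norm_completion.abs_eq cauchy_rel_refl Cauchy_convergent Cauchy_norm)
  then show ?thesis unfolding convergent_LIMSEQ_iff by simp
qed

lemma to_completion_seq_tendsto:
  assumes "Cauchy X"
  shows "(\<lambda>n. to_completion (X n)) \<longlonglongrightarrow> abs_completion X"
proof (rule LIMSEQ_I)
  fix e :: real assume "e > 0"
  then have e: "e / 2 > 0" by simp
  obtain M where M: "\<And>m n. m \<ge> M \<Longrightarrow> n \<ge> M \<Longrightarrow> norm (X m - X n) < e / 2"
    using CauchyD[OF assms e] by blast
  have "norm (to_completion (X m) - abs_completion X) < e" if "m \<ge> M" for m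
  proof -
    have "norm (abs_completion X - to_completion (X m)) \<le> e / 2"
      by (rule LIMSEQ_le_const2[OF norm_completion_seq[OF assms]]) (use M that less_imp_le in blast)
    then show ?thesis using \<open>e > 0\<close> by (simp add: norm_minus_commute)
  qed
  then show "\<exists>M. \<forall>m\<ge>M. norm (to_completion (X m) - abs_completion X) < e" by blast
qed

lemma dense_range_to_completion: "closure (range to_completion) = UNIV"
proof -
  have "z \<in> closure (range to_completion)" for z :: "'a completion"
  proof (induction z)
    case (1 X)
    then have "Cauchy X" by (simp add: cauchy_rel_def)
    then show ?case
      unfolding closure_sequential
      by (intro exI[of _ "\<lambda>n. to_completion (X n)"] conjI allI rangeI to_completion_seq_tendsto)
  qed
  then show ?thesis by blast
qed

instance completion :: (real_normed_vector) banach
proof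
  fix Z :: "nat \<Rightarrow> 'a completion" assume Z: "Cauchy Z"
  have "\<exists>x. dist (to_completion x) (Z n) < inverse (real (Suc n))" for n
  proof -
    have "Z n \<in> closure (range to_completion)" by (simp add: dense_range_to_completion)
    moreover have "0 < inverse (real (Suc n))" by simp
    ultimately show ?thesis unfolding closure_approachable by blast
  qed
  then obtain X where X: "\<And>n. dist (to_completion (X n)) (Z n) < inverse (real (Suc n))" by metis
  have diff: "(\<lambda>n. to_completion (X n) - Z n) \<longlonglongrightarrow> 0"
    by (rule Lim_null_comparison[OF _ LIMSEQ_inverse_real_of_nat])
      (use X less_imp_le in \<open>auto simp: dist_norm intro!: always_eventually\<close>)
  have "Cauchy (\<lambda>n. (to_completion (X n) - Z n) + Z n)"
    by (rule Cauchy_add_seq[OF LIMSEQ_imp_Cauchy[OF diff] Z])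
  then have "Cauchy X"
    by (simp add: Cauchy_def dist_norm norm_to_completion flip: linear_diff[OF linear_to_completion])
  then have "(\<lambda>n. to_completion (X n) - (to_completion (X n) - Z n)) \<longlonglongrightarrow> abs_completion X - 0"
    by (intro tendsto_diff to_completion_seq_tendsto diff)
  then have "Z \<longlonglongrightarrow> abs_completion X" by simp
  then show "convergent Z" by (rule convergentI)
qed

section \<open>The completed projective tensor product\<close>

type_synonym ('a, 'b) projective_tensor = "('a, 'b) tensor completion"

definition NA_pi :: "('a::real_normed_vector, 'b::real_normed_vector) projective_tensor set" where
  "NA_pi = {z. \<exists>x y. bounded (range (\<lambda>n::nat. (x n, y n))) \<and>
    summable (\<lambda>n. norm (x n) * norm (y n)) \<and>
    (\<lambda>n. to_completion (x n \<otimes> y n)) sums z \<and>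
    norm z = (\<Sum>n. norm (x n) * norm (y n))}"

end

theory Submission
  imports Defs
begin

text \<open>
  Writing the first factor of each elementary tensor as a nonnegative combination of the points
  \<open>s\<close> spanning the ball does not increase the cost, so up to \<open>\<epsilon>\<close> every tensor has an optimal
  representation \<open>\<Sum>s. s \<otimes> y\<^sub>s\<close> over this one finite set; summing a rapidly convergent series
  coefficientwise shows that the completion adds no new tensors. Near-optimal coefficient
  families are bounded, so they cluster weak* in the dual space \<open>Y\<close>. The cluster point represents
  the same tensor, because \<open>\<phi> \<otimes> \<zeta>\<close> with \<open>\<zeta>\<close> in the predual suffice to separate sums over a fixed
  finite set, and it is optimal by weak* lower semicontinuity of the norm.
\<close>

section \<open>Projective norm and equality of algebraic tensors\<close>

lemma norm_sum_tensor_le: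
  "norm (\<Sum>(x, y)\<leftarrow>ps. x \<otimes> y) \<le> (\<Sum>(x, y)\<leftarrow>ps. norm x * norm y)"
proof -
  have "0 \<le> (\<Sum>(x, y)\<leftarrow>qs. norm x * norm y)" for qs :: "('a \<times> 'b) list"
    by (induction qs) auto
  then show ?thesis
    unfolding norm_tensor_def by (intro cInf_lower bdd_belowI[of _ 0]) blast+
qed

lemma norm_tensor_le: "norm (x \<otimes> y) \<le> norm x * norm y"
  using norm_sum_tensor_le[of "[(x, y)]"] by simp

lemma norm_tensor_near_optimal:
  assumes "e > 0"
  obtains ps where "t = (\<Sum>(x, y)\<leftarrow>ps. x \<otimes> y)" "(\<Sum>(x, y)\<leftarrow>ps. norm x * norm y) < norm t + e"
proof -
  have "Inf {(\<Sum>(x, y)\<leftarrow>ps. norm x * norm y) |ps. t = (\<Sum>(x, y)\<leftarrow>ps. x \<otimes> y)} < norm t + e"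
    using assms by (simp flip: norm_tensor_def)
  moreover obtain ps where "t = (\<Sum>(x, y)\<leftarrow>ps. x \<otimes> y)" by (rule tensor_cases)
  ultimately show thesis using that by (smt (verit) cInf_lessD empty_Collect_eq mem_Collect_eq)
qed

text \<open>A tensor is by construction a functional on bilinear forms, so the right-hand side is
  the same for all representations of one tensor.\<close>

lemma Rep_tensor_sum:
  assumes "finite S" "bilinear B"
  shows "Rep_tensor (\<Sum>s\<in>S. s \<otimes> y s) B = (\<Sum>s\<in>S. B s (y s))"
  using assms
  by (induction S rule: finite_induct)
    (auto simp: zero_tensor.rep_eq plus_tensor.rep_eq tensor.rep_eq eval_pairs_def)

lemma bilinear_times_bounded_linear:
  fixes \<phi> :: "'a::real_normed_vector \<Rightarrow> real" and \<psi> :: "'b::real_normed_vector \<Rightarrow> real"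
  assumes "bounded_linear \<phi>" "bounded_linear \<psi>"
  shows "bilinear (\<lambda>x y. \<phi> x * \<psi> y)"
  using assms[THEN bounded_linear.linear] by (auto simp: bilinear_def linear_iff algebra_simps)

text \<open>Applying any bounded \<open>\<psi>\<close> to the assumed identity shows that every
  \<open>\<phi> \<otimes> \<psi>\<close> vanishes on the difference, and these products separate
  tensors. As the hypothesis is an identity in \<open>'b\<close>, any separating family of
  functionals, such as a predual, can verify it.\<close>

lemma sum_tensor_eqI:
  fixes y y' :: "'a::real_normed_vector \<Rightarrow> 'b::real_normed_vector"
  assumes S: "finite S"
    and eq: "\<And>\<phi> :: 'a \<Rightarrow> real. bounded_linear \<phi> \<Longrightarrow> (\<Sum>s\<in>S. \<phi> s *\<^sub>R y s) = (\<Sum>s\<in>S. \<phi> s *\<^sub>R y' s)"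
  shows "(\<Sum>s\<in>S. s \<otimes> y s) = (\<Sum>s\<in>S. s \<otimes> y' s)"
proof -
  define d where "d = (\<Sum>s\<in>S. s \<otimes> (y s - y' s))"
  obtain ps where ps: "d = (\<Sum>(x, y)\<leftarrow>ps. x \<otimes> y)" by (rule tensor_cases)
  have "(\<Sum>(x, y)\<leftarrow>ps. \<phi> x * \<psi> y) = 0" if b: "bounded_linear \<phi>" "bounded_linear \<psi>"
    for \<phi> :: "'a \<Rightarrow> real" and \<psi> :: "'b \<Rightarrow> real"
  proof -
    interpret \<psi>: bounded_linear \<psi> by (rule b(2))
    note bil = bilinear_times_bounded_linear[OF b]
    have "(\<Sum>(x, y)\<leftarrow>ps. \<phi> x * \<psi> y) = Rep_tensor d (\<lambda>x y. \<phi> x * \<psi> y)"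
      unfolding ps Rep_sum_tensor by (simp add: eval_pairs_def bil)
    also have "\<dots> = (\<Sum>s\<in>S. \<phi> s * \<psi> (y s - y' s))"
      unfolding d_def by (rule Rep_tensor_sum[OF S bil])
    also have "\<dots> = \<psi> ((\<Sum>s\<in>S. \<phi> s *\<^sub>R y s) - (\<Sum>s\<in>S. \<phi> s *\<^sub>R y' s))"
      by (simp add: \<psi>.diff \<psi>.sum \<psi>.scaleR sum_subtractf right_diff_distrib)
    also have "\<dots> = 0" by (simp add: eq[OF b(1)] \<psi>.zero)
    finally show ?thesis .
  qed
  then have "d = 0" unfolding ps by (rule sum_tensor_eq_0I)
  then show ?thesis
    by (simp add: d_def bilinear_rsub[OF bilinear_tensor] sum_subtractf)
qed

section \<open>Representations over the points spanning the ball\<close>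

lemma convex_hull_unit_ball_decompose:
  fixes S :: "'a::real_normed_vector set"
  assumes S: "finite S" "cball 0 1 = convex hull S"
  obtains c where "x = (\<Sum>s\<in>S. c s *\<^sub>R s)" "\<And>s. s \<in> S \<Longrightarrow> c s \<ge> 0" "sum c S = norm x"
proof -
  \<comment> \<open>For \<open>x = 0\<close> the quotient is \<open>0\<close>, which still lies in
    the ball.\<close>
  have "x /\<^sub>R norm x \<in> convex hull S" unfolding S(2)[symmetric] by (cases "x = 0") simp_all
  then obtain u where u: "\<And>s. s \<in> S \<Longrightarrow> u s \<ge> 0" "sum u S = 1" "(\<Sum>s\<in>S. u s *\<^sub>R s) = x /\<^sub>R norm x"
    unfolding convex_hull_finite[OF S(1)] by auto
  have "x = norm x *\<^sub>R (x /\<^sub>R norm x)" by (cases "x = 0") simp_all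
  also have "\<dots> = (\<Sum>s\<in>S. (norm x * u s) *\<^sub>R s)"
    unfolding u(3)[symmetric] scaleR_sum_right by simp
  finally show thesis
    using u(1,2) by (intro that[of "\<lambda>s. norm x * u s"]) (simp_all flip: sum_distrib_left)
qed

text \<open>Spreading \<open>a \<otimes> b\<close> over \<open>S\<close> puts
  \<open>c s *\<^sub>R b\<close> at \<open>s\<close>, at total cost
  \<open>sum c S * norm b = norm a * norm b\<close>; collecting coefficients at the same
  \<open>s\<close> can only lower the cost. Factors \<open>norm s\<close> are omitted, being at most
  1.\<close>

lemma sum_tensor_over_spanning_points:
  fixes S :: "'a::real_normed_vector set" and ps :: "('a \<times> 'b::real_normed_vector) list"
  assumes S: "finite S" "cball 0 1 = convex hull S"
  shows "\<exists>y. (\<Sum>(x, y)\<leftarrow>ps. x \<otimes> y) = (\<Sum>s\<in>S. s \<otimes> y s) \<and>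
    (\<Sum>s\<in>S. norm (y s)) \<le> (\<Sum>(x, y)\<leftarrow>ps. norm x * norm y)"
proof (induction ps)
  case Nil
  then show ?case by (intro exI[of _ "\<lambda>_. 0"]) (simp add: bilinear_rzero[OF bilinear_tensor])
next
  case (Cons p ps)
  obtain a b where p: "p = (a, b)" by force
  obtain y where y: "(\<Sum>(x, y)\<leftarrow>ps. x \<otimes> y) = (\<Sum>s\<in>S. s \<otimes> y s)"
    "(\<Sum>s\<in>S. norm (y s)) \<le> (\<Sum>(x, y)\<leftarrow>ps. norm x * norm y)" using Cons by blast
  obtain c where c: "a = (\<Sum>s\<in>S. c s *\<^sub>R s)" "\<And>s. s \<in> S \<Longrightarrow> c s \<ge> 0" "sum c S = norm a"
    using convex_hull_unit_ball_decompose[OF S] by metis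
  interpret L: linear "\<lambda>a. a \<otimes> b" using bilinear_tensor unfolding bilinear_def by blast
  have "a \<otimes> b = (\<Sum>s\<in>S. s \<otimes> (c s *\<^sub>R b))"
    by (subst c(1)) (simp add: L.sum L.scale bilinear_rmul[OF bilinear_tensor])
  then have "(\<Sum>(x, y)\<leftarrow>p # ps. x \<otimes> y) = (\<Sum>s\<in>S. s \<otimes> (c s *\<^sub>R b + y s))"
    using y(1) by (simp add: p bilinear_radd[OF bilinear_tensor] sum.distrib)
  moreover have "(\<Sum>s\<in>S. norm (c s *\<^sub>R b + y s)) \<le> (\<Sum>s\<in>S. c s * norm b + norm (y s))"
    using c(2) by (intro sum_mono order_trans[OF norm_triangle_ineq]) simp
  moreover have "\<dots> \<le> (\<Sum>(x, y)\<leftarrow>p # ps. norm x * norm y)"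
    using y(2) by (simp add: p sum.distrib c(3) flip: sum_distrib_right)
  ultimately show ?case by (meson order_trans)
qed

lemma tensor_near_optimal_over_spanning_points:
  fixes S :: "'a::real_normed_vector set" and t :: "('a, 'b::real_normed_vector) tensor"
  assumes S: "finite S" "cball 0 1 = convex hull S" and "e > 0"
  obtains y where "t = (\<Sum>s\<in>S. s \<otimes> y s)" "(\<Sum>s\<in>S. norm (y s)) < norm t + e"
proof -
  obtain ps where ps: "t = (\<Sum>(x, y)\<leftarrow>ps. x \<otimes> y)" "(\<Sum>(x, y)\<leftarrow>ps. norm x * norm y) < norm t + e"
    using norm_tensor_near_optimal[OF assms(3)] .
  then show thesis
    using sum_tensor_over_spanning_points[OF S, of ps] that order_le_less_trans by auto
qed

section \<open>The completion adds no tensors\<close>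

lemma bounded_linear_to_completion_tensor: "bounded_linear (\<lambda>y. to_completion (a \<otimes> y))"
proof (rule bounded_linear_intro)
  show "norm (to_completion (a \<otimes> y)) \<le> norm y * norm a" for y
    using norm_tensor_le[of a y] by (simp add: norm_to_completion mult.commute)
qed (simp_all add: bilinear_radd[OF bilinear_tensor] bilinear_rmul[OF bilinear_tensor]
    linear_add[OF linear_to_completion] linear_scale[OF linear_to_completion])

text \<open>Completeness of \<open>'b\<close> enters here: for each of the finitely many
  \<open>s\<close> the coefficients of the increments form an absolutely convergent series, so the
  telescoped series collapses to one algebraic tensor.\<close>

lemma surj_to_completion_tensor:
  fixes S :: "'a::real_normed_vector set" and z :: "('a, 'b::banach) projective_tensor"
  assumes S: "finite S" "cball 0 1 = convex hull S"
  obtains t where "z = to_completion t"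
proof -
  have "\<exists>t. dist (to_completion t) z < (1/2) ^ k" for k :: nat
    using dense_range_to_completion[where 'a = "('a, 'b) tensor"]
    unfolding set_eq_iff closure_approachable by simp
  then obtain t where t: "\<And>k. dist (to_completion (t k)) z < (1/2) ^ k" by metis
  have d: "norm (t (Suc k) - t k) < 2 * (1/2) ^ k" for k
  proof -
    have "norm (t (Suc k) - t k) = dist (to_completion (t (Suc k))) (to_completion (t k))"
      by (simp add: dist_norm norm_to_completion flip: linear_diff[OF linear_to_completion])
    also have "\<dots> \<le> dist (to_completion (t (Suc k))) z + dist (to_completion (t k)) z"
      by (rule dist_triangle2)
    also have "\<dots> < (1/2) ^ Suc k + (1/2) ^ k" using t by (intro add_strict_mono)
    finally show ?thesis by (simp add: field_simps)
  qed
  \<comment> \<open>The tolerance shrinks with \<open>k\<close> to keep the coefficients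
    summable.\<close>
  have "\<exists>y. t (Suc k) - t k = (\<Sum>s\<in>S. s \<otimes> y s) \<and> (\<Sum>s\<in>S. norm (y s)) < norm (t (Suc k) - t k) + (1/2) ^ k" for k
    by (rule tensor_near_optimal_over_spanning_points[OF S]) auto
  then obtain y where y: "\<And>k. t (Suc k) - t k = (\<Sum>s\<in>S. s \<otimes> y k s)"
    "\<And>k. (\<Sum>s\<in>S. norm (y k s)) < norm (t (Suc k) - t k) + (1/2) ^ k" by metis
  have le: "norm (y k s) \<le> 3 * (1/2) ^ k" if "s \<in> S" for k s
    using member_le_sum[OF that, of "\<lambda>s. norm (y k s)"] S(1) y(2)[of k] d[of k] by simp
  have "summable (\<lambda>k. y k s)" if "s \<in> S" for s
    by (rule summable_comparison_test[of _ "\<lambda>k. 3 * (1/2) ^ k"])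
      (use le[OF that] in \<open>auto intro!: summable_mult summable_geometric\<close>)
  then have "(\<lambda>k. to_completion (s \<otimes> y k s)) sums to_completion (s \<otimes> (\<Sum>k. y k s))" if "s \<in> S" for s
    using bounded_linear.sums[OF bounded_linear_to_completion_tensor] that summable_sums by blast
  then have "(\<lambda>k. \<Sum>s\<in>S. to_completion (s \<otimes> y k s)) sums (\<Sum>s\<in>S. to_completion (s \<otimes> (\<Sum>k. y k s)))"
    by (rule sums_sum)
  then have *: "(\<lambda>k. to_completion (t (Suc k)) - to_completion (t k)) sums
      to_completion (\<Sum>s\<in>S. s \<otimes> (\<Sum>k. y k s))"
    by (simp add: y(1) linear_sum[OF linear_to_completion] flip: linear_diff[OF linear_to_completion])
  have "(\<lambda>k. to_completion (t k)) \<longlonglongrightarrow> z"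
    by (rule LIM_zero_cancel, rule Lim_null_comparison[of _ "\<lambda>k. (1/2) ^ k"])
      (use t less_imp_le in \<open>auto simp: dist_norm intro!: always_eventually LIMSEQ_power_zero\<close>)
  then have "(\<lambda>k. to_completion (t (Suc k)) - to_completion (t k)) sums (z - to_completion (t 0))"
    by (rule telescope_sums)
  \<comment> \<open>Telescoping yields \<open>z - to_completion (t 0)\<close>, so \<open>t 0\<close>
    is added back.\<close>
  from sums_unique2[OF this *] show thesis
    using that[of "(\<Sum>s\<in>S. s \<otimes> (\<Sum>k. y k s)) + t 0"]
    by (simp add: linear_add[OF linear_to_completion] algebra_simps)
qed

section \<open>Weak* cluster points\<close>

text \<open>Tychonoff: all \<open>g k\<close> lie in a product of compact intervals. A filter
  replaces a subsequence because the index type is arbitrary and such a product need not be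
  sequentially compact; \<open>F \<le> sequentially\<close> keeps ordinary limits valid along
  \<open>F\<close>.\<close>

lemma pointwise_cluster:
  fixes g :: "nat \<Rightarrow> 'a \<Rightarrow> real"
  assumes bound: "\<And>k a. \<bar>g k a\<bar> \<le> C a"
  obtains F l where "F \<noteq> bot" "F \<le> sequentially" "\<And>a. ((\<lambda>k. g k a) \<longlongrightarrow> l a) F"
proof -
  define K where "K = PiE UNIV (\<lambda>a. {- C a..C a})"
  have "compactin (product_topology (\<lambda>a. euclidean) UNIV) K"
    unfolding K_def compactin_PiE by simp
  then have "compact K" unfolding euclidean_product_topology by simp
  moreover have "g k \<in> K" for k using bound by (auto simp: K_def abs_le_iff minus_le_iff)
  then have "eventually (\<lambda>f. f \<in> K) (filtermap g sequentially)" by (simp add: eventually_filtermap)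
  moreover have "filtermap g sequentially \<noteq> bot" by (simp add: filtermap_bot_iff)
  ultimately obtain l where l: "inf (nhds l) (filtermap g sequentially) \<noteq> bot"
    unfolding compact_filter by blast
  \<comment> \<open>Pulling neighbourhoods of the cluster point back along \<open>g\<close> forces
    \<open>g\<close> to converge to \<open>l\<close> along \<open>F\<close>.\<close>
  define F where "F = inf (filtercomap g (nhds l)) sequentially"
  have "F \<noteq> bot"
  proof
    assume "F = bot"
    then have "eventually (\<lambda>_. False) F" by simp
    then obtain P Q where P: "eventually P (nhds l)" and Q: "eventually Q sequentially"
      and PQ: "\<And>k. P (g k) \<Longrightarrow> \<not> Q k"
      unfolding F_def eventually_inf eventually_filtercomap by blast
    \<comment> \<open>If \<open>F\<close> were trivial, \<open>g k\<close> would eventually avoid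
      the neighbourhood \<open>P\<close> of \<open>l\<close>, so \<open>l\<close> would not be a
      cluster point.\<close>
    have "eventually (\<lambda>f. \<not> P f) (filtermap g sequentially)"
      unfolding eventually_filtermap using Q by eventually_elim (use PQ in blast)
    with P have "eventually (\<lambda>_. False) (inf (nhds l) (filtermap g sequentially))"
      unfolding eventually_inf by blast
    with l show False by (simp add: trivial_limit_def)
  qed
  moreover have "filterlim g (nhds l) F"
    by (simp add: F_def filterlim_iff_le_filtercomap)
  then have "((\<lambda>k. g k a) \<longlongrightarrow> l a) F" for a
    using continuous_on_tendsto_compose[OF continuous_on_product_coordinates[of a]] by fastforce
  moreover have "F \<le> sequentially" by (simp add: F_def)
  ultimately show thesis using that by blast
qed

text \<open>The norms \<open>norm (y k i)\<close> are made to converge along the same filter, which turns weak* lower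
  semicontinuity into \<open>norm (l i) \<le> r i\<close>.\<close>
lemma bounded_dual_cluster:
  fixes T :: "'y::real_normed_vector \<Rightarrow> ('z::real_normed_vector \<Rightarrow>\<^sub>L real)" and y :: "nat \<Rightarrow> 'i \<Rightarrow> 'y"
  assumes T: "surj T" "\<And>y. norm (T y) = norm y"
    and bound: "\<And>k i. norm (y k i) \<le> C"
  obtains F l r where "F \<noteq> bot" "F \<le> sequentially"
    "\<And>i \<zeta>. ((\<lambda>k. blinfun_apply (T (y k i)) \<zeta>) \<longlongrightarrow> blinfun_apply (T (l i)) \<zeta>) F"
    "\<And>i. ((\<lambda>k. norm (y k i)) \<longlongrightarrow> r i) F" "\<And>i. norm (l i) \<le> r i"
proof -
  \<comment> \<open>\<open>None\<close> carries the norm and \<open>Some \<zeta>\<close> the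
    evaluation at \<open>\<zeta>\<close>, so a single compactness argument serves both.\<close>
  define g where "g k = (\<lambda>(i, \<zeta>). case \<zeta> of None \<Rightarrow> norm (y k i) | Some \<zeta> \<Rightarrow> blinfun_apply (T (y k i)) \<zeta>)" for k
  have gb: "\<bar>blinfun_apply (T (y k i)) \<zeta>\<bar> \<le> norm (y k i) * norm \<zeta>" for k i \<zeta>
    using norm_blinfun[of "T (y k i)" \<zeta>] by (simp add: T(2))
  then have "\<bar>blinfun_apply (T (y k i)) \<zeta>\<bar> \<le> C * norm \<zeta>" for k i \<zeta>
    using mult_right_mono[OF bound[of k i] norm_ge_zero[of \<zeta>]] order_trans by blast
  then have "\<bar>g k p\<bar> \<le> (case p of (i, \<zeta>) \<Rightarrow> case \<zeta> of None \<Rightarrow> C | Some \<zeta> \<Rightarrow> C * norm \<zeta>)" for k p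
    using bound by (auto simp: g_def split: prod.split option.split)
  then obtain F h where F: "F \<noteq> bot" "F \<le> sequentially" and h: "\<And>p. ((\<lambda>k. g k p) \<longlongrightarrow> h p) F"
    using pointwise_cluster[of g] by blast
  define r where "r i = h (i, None)" for i
  define f where "f i \<zeta> = h (i, Some \<zeta>)" for i \<zeta>
  have r: "((\<lambda>k. norm (y k i)) \<longlongrightarrow> r i) F" for i using h[of "(i, None)"] by (simp add: g_def r_def)
  have f: "((\<lambda>k. blinfun_apply (T (y k i)) \<zeta>) \<longlongrightarrow> f i \<zeta>) F" for i \<zeta>
    using h[of "(i, Some \<zeta>)"] by (simp add: g_def f_def)
  \<comment> \<open>Passing to the limit in \<open>gb\<close> bounds \<open>f i\<close> by the limit
    \<open>r i\<close> of the norms instead of the cruder \<open>C\<close>.\<close>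
  have f_le: "norm (f i \<zeta>) \<le> r i * norm \<zeta>" for i \<zeta>
    by (rule tendsto_le[OF F(1) tendsto_mult_right[OF r] tendsto_norm[OF f]]) (simp add: gb)
  have lin: "bounded_linear (f i)" for i
  proof (rule bounded_linear_intro)
    show "norm (f i \<zeta>) \<le> norm \<zeta> * r i" for \<zeta> using f_le[of i \<zeta>] by (simp add: mult.commute)
    show "f i (\<zeta> + \<zeta>') = f i \<zeta> + f i \<zeta>'" for \<zeta> \<zeta>'
      by (rule tendsto_unique[OF F(1) f]) (simp add: blinfun.add_right tendsto_add f)
    show "f i (c *\<^sub>R \<zeta>) = c *\<^sub>R f i \<zeta>" for c \<zeta>
      by (rule tendsto_unique[OF F(1) f]) (simp add: blinfun.scaleR_right tendsto_mult_left f)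
  qed
  \<comment> \<open>Surjectivity of \<open>T\<close> turns the limit functional into an element of
    \<open>'y\<close>.\<close>
  define l where "l i = inv T (Blinfun (f i))" for i
  have Tl: "blinfun_apply (T (l i)) = f i" for i by (simp add: l_def surj_f_inv_f[OF T(1)] bounded_linear_Blinfun_apply lin)
  have "0 \<le> r i" for i by (rule tendsto_lowerbound[OF r _ F(1)]) simp
  then have "norm (l i) \<le> r i" for i
    unfolding T(2)[symmetric] by (intro norm_blinfun_bound) (simp_all add: Tl f_le[unfolded real_norm_def])
  then show thesis by (rule that[OF F f[folded Tl] r])
qed

section \<open>Optimal representations and norm attainment\<close>

lemma tensor_optimal_over_spanning_points:
  fixes S :: "'a::real_normed_vector set" and t :: "('a, 'b::real_normed_vector) tensor"
    and T :: "'b \<Rightarrow> ('z::real_normed_vector \<Rightarrow>\<^sub>L real)"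
  assumes S: "finite S" "cball 0 1 = convex hull S"
    and T: "linear T" "surj T" "\<And>y. norm (T y) = norm y"
  obtains y where "t = (\<Sum>s\<in>S. s \<otimes> y s)" "(\<Sum>s\<in>S. norm (y s)) \<le> norm t"
proof -
  have "\<exists>y. t = (\<Sum>s\<in>S. s \<otimes> y s) \<and> (\<Sum>s\<in>S. norm (y s)) < norm t + inverse (real (Suc k))" for k
    by (rule tensor_near_optimal_over_spanning_points[OF S]) auto
  then obtain y0 where y0: "\<And>k. t = (\<Sum>s\<in>S. s \<otimes> y0 k s)"
    "\<And>k. (\<Sum>s\<in>S. norm (y0 k s)) < norm t + inverse (real (Suc k))" by metis
  \<comment> \<open>Zero outside \<open>S\<close>, since the cluster lemma asks for a bound at every
    index.\<close>
  define y where "y k s = (if s \<in> S then y0 k s else 0)" for k s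
  have y: "t = (\<Sum>s\<in>S. s \<otimes> y k s)" "(\<Sum>s\<in>S. norm (y k s)) \<le> norm t + inverse (real (Suc k))" for k
    using y0 less_imp_le by (auto simp: y_def)
  have "norm (y k s) \<le> norm t + 1" for k s
  proof (cases "s \<in> S")
    case True
    have "inverse (real (Suc k)) \<le> 1" by (simp add: field_simps)
    then show ?thesis
      using member_le_sum[OF True, of "\<lambda>s. norm (y k s)"] S(1) y(2)[of k] by simp
  qed (simp add: y_def)
  then obtain F l r where F: "F \<noteq> bot" "F \<le> sequentially"
    and l: "\<And>s \<zeta>. ((\<lambda>k. blinfun_apply (T (y k s)) \<zeta>) \<longlongrightarrow> blinfun_apply (T (l s)) \<zeta>) F"
    and r: "\<And>s. ((\<lambda>k. norm (y k s)) \<longlongrightarrow> r s) F" "\<And>s. norm (l s) \<le> r s"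
    using bounded_dual_cluster[OF T(2,3)] by metis
  have "(\<lambda>k. norm t + inverse (real (Suc k))) \<longlonglongrightarrow> norm t"
    using tendsto_add[OF tendsto_const LIMSEQ_inverse_real_of_nat] by force
  then have "((\<lambda>k. norm t + inverse (real (Suc k))) \<longlongrightarrow> norm t) F"
    using F(2) tendsto_mono by blast
  then have "(\<Sum>s\<in>S. r s) \<le> norm t"
    by (rule tendsto_le[OF F(1) _ tendsto_sum[OF r(1)]]) (use y(2) in simp)
  then have le: "(\<Sum>s\<in>S. norm (l s)) \<le> norm t"
    using sum_mono[of S "\<lambda>s. norm (l s)" r] r(2) by force
  have inj: "u = v" if "T u = T v" for u v
    using T(3)[of "u - v"] that by (simp add: linear_diff[OF T(1)])
  have "(\<Sum>s\<in>S. \<phi> s *\<^sub>R y 0 s) = (\<Sum>s\<in>S. \<phi> s *\<^sub>R l s)" if \<phi>: "bounded_linear \<phi>" for \<phi> :: "'a \<Rightarrow> real"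
  proof (rule inj, rule blinfun_eqI)
    fix \<zeta>
    \<comment> \<open>The form \<open>\<phi> \<otimes> \<zeta>\<close> with \<open>\<zeta>\<close>
      in the predual: its values pass to the weak* limit, and they are constant in \<open>k\<close>
      because every \<open>y k\<close> represents \<open>t\<close>.\<close>
    define B where "B = (\<lambda>x v. \<phi> x * blinfun_apply (T v) \<zeta>)"
    have B: "bilinear B"
      using linear_add[OF bounded_linear.linear[OF \<phi>]] linear_scale[OF bounded_linear.linear[OF \<phi>]]
      by (simp add: B_def bilinear_def linear_iff linear_add[OF T(1)] linear_scale[OF T(1)]
          blinfun.add_left blinfun.scaleR_left algebra_simps)
    have TB: "blinfun_apply (T (\<Sum>s\<in>S. \<phi> s *\<^sub>R v s)) \<zeta> = (\<Sum>s\<in>S. B s (v s))" for v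
      by (simp add: B_def linear_sum[OF T(1)] linear_scale[OF T(1)] blinfun.sum_left blinfun.scaleR_left)
    have "((\<lambda>k. \<Sum>s\<in>S. B s (y k s)) \<longlongrightarrow> (\<Sum>s\<in>S. B s (l s))) F"
      unfolding B_def by (intro tendsto_sum tendsto_mult_left l)
    moreover have "(\<lambda>k. \<Sum>s\<in>S. B s (y k s)) = (\<lambda>k. \<Sum>s\<in>S. B s (y 0 s))"
      using Rep_tensor_sum[OF S(1) B] y(1) by metis
    ultimately have "((\<lambda>k. \<Sum>s\<in>S. B s (y 0 s)) \<longlongrightarrow> (\<Sum>s\<in>S. B s (l s))) F" by simp
    from tendsto_unique[OF F(1) tendsto_const this]
    have "(\<Sum>s\<in>S. B s (y 0 s)) = (\<Sum>s\<in>S. B s (l s))" .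
    then show "blinfun_apply (T (\<Sum>s\<in>S. \<phi> s *\<^sub>R y 0 s)) \<zeta> = blinfun_apply (T (\<Sum>s\<in>S. \<phi> s *\<^sub>R l s)) \<zeta>"
      by (simp only: TB)
  qed
  then have "t = (\<Sum>s\<in>S. s \<otimes> l s)"
    using sum_tensor_eqI[OF S(1)] y(1)[of 0] by metis
  then show thesis using le that by blast
qed

text \<open>Enumerating \<open>S\<close> and padding with zero pairs gives a sequence of finite
  range whose series are finite sums. One inequality suffices as hypothesis, the other holds for
  every representation.\<close>

lemma sum_tensor_in_NA_pi:
  assumes S: "finite S" and le: "(\<Sum>s\<in>S. norm s * norm (y s)) \<le> norm (\<Sum>s\<in>S. s \<otimes> y s)"
  shows "to_completion (\<Sum>s\<in>S. s \<otimes> y s) \<in> NA_pi"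
proof -
  obtain e where e: "bij_betw e {..<card S} S"
    using ex_bij_betw_nat_finite[OF S] by (auto simp: lessThan_atLeast0)
  define a where "a k = (if k < card S then e k else 0)" for k
  define b where "b k = (if k < card S then y (e k) else 0)" for k
  have "range (\<lambda>k. (a k, b k)) \<subseteq> insert (0, 0) ((\<lambda>k. (e k, y (e k))) ` {..<card S})"
    by (auto simp: a_def b_def)
  then have bdd: "bounded (range (\<lambda>k. (a k, b k)))"
    by (intro finite_imp_bounded) (rule finite_subset, auto)
  have reindex: "(\<Sum>k<card S. h (e k)) = sum h S" for h :: "_ \<Rightarrow> 'c::comm_monoid_add"
    by (rule sum.reindex_bij_betw[OF e])
  have "(\<lambda>k. norm (a k) * norm (b k)) sums (\<Sum>k<card S. norm (a k) * norm (b k))"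
    by (rule sums_finite) (auto simp: a_def)
  also have "(\<Sum>k<card S. norm (a k) * norm (b k)) = (\<Sum>s\<in>S. norm s * norm (y s))"
    unfolding reindex[symmetric] by (intro sum.cong) (auto simp: a_def b_def)
  finally have cost: "(\<lambda>k. norm (a k) * norm (b k)) sums (\<Sum>s\<in>S. norm s * norm (y s))" .
  have "(\<lambda>k. to_completion (a k \<otimes> b k)) sums (\<Sum>k<card S. to_completion (a k \<otimes> b k))"
    by (rule sums_finite) (auto simp: a_def bilinear_lzero[OF bilinear_tensor] linear_0[OF linear_to_completion])
  also have "(\<Sum>k<card S. to_completion (a k \<otimes> b k)) = (\<Sum>s\<in>S. to_completion (s \<otimes> y s))"
    unfolding reindex[symmetric] by (intro sum.cong) (auto simp: a_def b_def)
  finally have z: "(\<lambda>k. to_completion (a k \<otimes> b k)) sums to_completion (\<Sum>s\<in>S. s \<otimes> y s)"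
    by (simp add: linear_sum[OF linear_to_completion])
  have "norm (\<Sum>s\<in>S. s \<otimes> y s) \<le> (\<Sum>s\<in>S. norm s * norm (y s))"
    by (rule sum_norm_le) (rule norm_tensor_le)
  then have "norm (to_completion (\<Sum>s\<in>S. s \<otimes> y s)) = (\<Sum>k. norm (a k) * norm (b k))"
    using le sums_unique[OF cost] by (simp add: norm_to_completion)
  then show ?thesis
    unfolding NA_pi_def using bdd cost z sums_summable by blast
qed

theorem theorem4p1:
  fixes x :: "nat \<Rightarrow> 'x::banach" and n :: nat
  assumes "\<And>i. i \<in> {1..n} \<Longrightarrow> x i \<in> sphere 0 1"
    and "cball (0::'x) 1 = convex hull (x ` {1..n})"
    and "\<exists>T :: 'y::banach \<Rightarrow> ('z::banach \<Rightarrow>\<^sub>L real).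
           linear T \<and> surj T \<and> (\<forall>y. norm (T y) = norm y)"
  shows "(NA_pi :: ('x, 'y) projective_tensor set) = UNIV"
proof -
  define S where "S = x ` {1..n}"
  have S: "finite S" "cball 0 1 = convex hull S" using assms(2) by (simp_all add: S_def)
  have norm1: "norm s = 1" if "s \<in> S" for s using that assms(1) by (auto simp: S_def)
  obtain T :: "'y \<Rightarrow> ('z \<Rightarrow>\<^sub>L real)" where T: "linear T" "surj T" "\<And>y. norm (T y) = norm y"
    using assms(3) by blast
  have "z \<in> NA_pi" for z :: "('x, 'y) projective_tensor"
  proof -
    obtain t where z: "z = to_completion t" using surj_to_completion_tensor[OF S] .
    obtain y where y: "t = (\<Sum>s\<in>S. s \<otimes> y s)" "(\<Sum>s\<in>S. norm (y s)) \<le> norm t"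
      using tensor_optimal_over_spanning_points[OF S T] .
    \<comment> \<open>The points of \<open>S\<close> are unit vectors, so
      \<open>norm s * norm (y s)\<close> reduces to \<open>norm (y s)\<close>.\<close>
    show ?thesis
      unfolding z y(1) using y by (intro sum_tensor_in_NA_pi S(1)) (simp add: norm1)
  qed
  then show ?thesis by blast
qed

end
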